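(* For every non-negative integer $n$ and all integers $k$, $s$ and $t$, the following identities hold: \[(-1)^{nk+t-1}F_k\sum_{j=0}^n(-1)^{kj}F_{n(s-k)+s-t+2kj}=F_tF_{(s+k)(n+1)}-F_{t+(n+1)k}F_{s(n+1)},\] \[(-1)^{nk+t-1}F_k\sum_{j=0}^n(-1)^{kj}L_{n(s-k)+s-t+2kj}=F_tL_{(s+k)(n+1)}-F_{t+(n+1)k}L_{s(n+1)},\] \[(-1)^{nt+k-1}F_t\sum_{j=0}^n(-1)^{tj}F_{n(s-t)+s-k+2tj}=F_kF_{(s+t)(n+1)}-F_{k+(n+1)t}F_{s(n+1)},\] \[(-1)^{nt+k-1}F_t\sum_{j=0}^n(-1)^{tj}L_{n(s-t)+s-k+2tj}=F_kL_{(s+t)(n+1)}-F_{k+(n+1)t}L_{s(n+1)},\] \[(-1)^{ns+t-1}F_s\sum_{j=0}^n(-1)^{sj}F_{n(k-s)+k-t+2sj}=F_tF_{(k+s)(n+1)}-F_{t+(n+1)s}F_{k(n+1)},\] \[(-1)^{ns+t-1}F_s\sum_{j=0}^n(-1)^{sj}L_{n(k-s)+k-t+2sj}=F_tL_{(k+s)(n+1)}-F_{t+(n+1)s}L_{k(n+1)}.\]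
   Context: The Fibonacci numbers $F_n$ and Lucas numbers $L_n$ are defined for all integers $n$ by $F_0=0$, $F_1=1$, $F_n=F_{n-1}+F_{n-2}$ for $n\ge 2$; $L_0=2$, $L_1=1$, $L_n=L_{n-1}+L_{n-2}$ for $n\ge 2$; and $F_{-n}=(-1)^{n-1}F_n$, $L_{-n}=(-1)^nL_n$. *)

theory Defs
  imports "HOL-Number_Theory.Fib"
begin

text \<open>The Fibonacci and Lucas numbers with arbitrary integer index. The exponent in
  \<open>F\<^sub>-\<^sub>n = (-1)\<^sup>n\<^sup>-\<^sup>1 F\<^sub>n\<close> is only used for \<open>n > 0\<close>, so the truncated subtraction is harmless.\<close>

definition fib_int :: "int \<Rightarrow> int" where
  "fib_int m = (if m \<ge> 0 then int (fib (nat m))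
                else (- 1) ^ (nat (- m) - 1) * int (fib (nat (- m))))"

fun lucas :: "nat \<Rightarrow> nat" where
  "lucas 0 = 2"
| "lucas (Suc 0) = 1"
| "lucas (Suc (Suc n)) = lucas (Suc n) + lucas n"

definition lucas_int :: "int \<Rightarrow> int" where
  "lucas_int m = (if m \<ge> 0 then int (lucas (nat m))
                  else (- 1) ^ nat (- m) * int (lucas (nat (- m))))"

text \<open>Exponents of \<open>-1\<close> may be negative, and \<open>(powi)\<close> is not available on \<open>int\<close>; so the
  identities are stated in \<open>real\<close>, using the following embeddings of the integer sequences.\<close>

abbreviation F :: "int \<Rightarrow> real" where "F m \<equiv> real_of_int (fib_int m)"

abbreviation L :: "int \<Rightarrow> real" where "L m \<equiv> real_of_int (lucas_int m)"

end

theory Submission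
  imports Defs
begin

text \<open>
  Every identity is a telescoping sum. Let \<open>G\<close> be any two-sided sequence with
  \<open>G (m + 2) = G (m + 1) + G m\<close>. The generalised d'Ocagne identity
  \<open>(-1)\<^sup>t\<^sup>-\<^sup>1 F\<^sub>k G\<^sub>s\<^sub>-\<^sub>t = F\<^sub>t G\<^sub>s\<^sub>+\<^sub>k - F\<^sub>t\<^sub>+\<^sub>k G\<^sub>s\<close> (lemma \<open>dOcagne\<close>) holds for all integers \<open>k\<close>,
  \<open>s\<close>, \<open>t\<close>: both sides are solutions of the recurrence in \<open>k\<close>, and they agree at \<open>k = 0\<close> and \<open>k = 1\<close>.
  With \<open>S = s (n + 1)\<close>, replacing \<open>t\<close> by \<open>t + k (n - j)\<close> and \<open>s\<close> by \<open>S + k j\<close> turns its left-hand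
  side into the \<open>j\<close>-th summand, prefactor included, while its right-hand side becomes
  \<open>A\<^sub>j\<^sub>+\<^sub>1 - A\<^sub>j\<close> for \<open>A\<^sub>j = F (t + k (n + 1 - j)) * G (S + k j)\<close>. Summing over \<open>j\<close> leaves
  \<open>A\<^sub>n\<^sub>+\<^sub>1 - A\<^sub>0\<close> (lemma \<open>sum_fib_rec\<close>). The six identities are the cases \<open>G = F\<close> and \<open>G = L\<close>
  under permutations of \<open>k\<close>, \<open>s\<close>, \<open>t\<close>.
\<close>

text \<open>Two-sided real sequences satisfying the Fibonacci recurrence, with arbitrary initial values.\<close>

definition fib_rec :: "(int \<Rightarrow> real) \<Rightarrow> bool" where
  "fib_rec G \<longleftrightarrow> (\<forall>m. G (m + 2) = G (m + 1) + G m)"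

lemma fib_recD: "fib_rec G \<Longrightarrow> G (m + 2) = G (m + 1) + G m"
  by (simp add: fib_rec_def)

lemma fib_rec_shift:
  assumes "fib_rec G"
  shows "fib_rec (\<lambda>m. G (a + m))"
  using fib_recD[OF assms, of "a + m" for m] by (simp add: fib_rec_def add.assoc)

lemma fib_rec_mult: "fib_rec G \<Longrightarrow> fib_rec (\<lambda>m. c * G m)"
  by (simp add: fib_rec_def distrib_left)

lemma fib_rec_diff: "fib_rec G \<Longrightarrow> fib_rec H \<Longrightarrow> fib_rec (\<lambda>m. G m - H m)"
  by (simp add: fib_rec_def)

lemma fib_rec_eqI:
  assumes G: "fib_rec G" and H: "fib_rec H" and "G 0 = H 0" "G 1 = H 1"
  shows "G m = H m"
proof -
  have "G m = H m \<and> G (m + 1) = H (m + 1)"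
  proof (induction m rule: int_induct[where k = 0])
    case base
    then show ?case using assms by simp
  next
    case (step1 i)
    then show ?case using fib_recD[OF G, of i] fib_recD[OF H, of i] by (simp add: add.commute)
  next
    case (step2 i)
    then show ?case using fib_recD[OF G, of "i - 1"] fib_recD[OF H, of "i - 1"] by (simp add: add.commute)
  qed
  then show ?thesis by simp
qed

lemma fib_int_of_nat: "fib_int (int n) = int (fib n)"
  by (simp add: fib_int_def)

lemma fib_int_neg: "fib_int (- int n) = - ((- 1) ^ n * int (fib n))"
  by (cases n) (simp_all add: fib_int_def nat_add_distrib)

lemma lucas_int_of_nat: "lucas_int (int n) = int (lucas n)"
  by (simp add: lucas_int_def)

lemma lucas_int_neg: "lucas_int (- int n) = (- 1) ^ n * int (lucas n)"
  by (simp add: lucas_int_def)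

text \<open>Unless \<open>m = -1\<close>, the indices \<open>m\<close>, \<open>m + 1\<close>, \<open>m + 2\<close> are all \<open>\<ge> 0\<close> or all \<open>\<le> 0\<close>, so that one closed
  form serves all three terms of the recurrence at \<open>m\<close>.\<close>

lemma int_cases_recurrence:
  fixes m :: int
  obtains (nonneg) n where "m = int n" | (minus_one) "m = - 1"
    | (neg) n where "m = - int (n + 2)"
proof -
  consider "m \<ge> 0" | "m = - 1" | "m \<le> - 2" by linarith
  then show thesis
  proof cases
    case 1
    then show ?thesis using nonneg[of "nat m"] by simp
  next
    case 2
    then show ?thesis by (rule minus_one)
  next
    case 3
    then show ?thesis using neg[of "nat (- m - 2)"] by simp
  qed
qed

lemma fib_int_rec: "fib_int (m + 2) = fib_int (m + 1) + fib_int m"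
proof (cases m rule: int_cases_recurrence)
  case (nonneg n)
  then show ?thesis
    using fib_int_of_nat[of n] fib_int_of_nat[of "n + 1"] fib_int_of_nat[of "n + 2"]
    by (simp add: add.commute)
next
  case minus_one
  then show ?thesis by (simp add: fib_int_def)
next
  case (neg n)
  then have "m + 1 = - int (n + 1)" "m + 2 = - int n" by simp_all
  with neg show ?thesis by (simp only: fib_int_neg) (simp add: algebra_simps)
qed

lemma lucas_int_rec: "lucas_int (m + 2) = lucas_int (m + 1) + lucas_int m"
proof (cases m rule: int_cases_recurrence)
  case (nonneg n)
  then show ?thesis
    using lucas_int_of_nat[of n] lucas_int_of_nat[of "n + 1"] lucas_int_of_nat[of "n + 2"]
    by (simp add: add.commute)
next
  case minus_one
  then show ?thesis by (simp add: lucas_int_def)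
next
  case (neg n)
  then have "m + 1 = - int (n + 1)" "m + 2 = - int n" by simp_all
  with neg show ?thesis by (simp only: lucas_int_neg) (simp add: algebra_simps)
qed

lemma fib_rec_F: "fib_rec F"
  by (simp add: fib_rec_def fib_int_rec)

lemma fib_rec_L: "fib_rec L"
  by (simp add: fib_rec_def lucas_int_rec)

lemma F_0: "F 0 = 0" and F_1: "F 1 = 1"
  by (simp_all add: fib_int_def)

text \<open>
  The case \<open>k = 1\<close> of the identity below: the determinant on the right changes sign when \<open>s\<close> and
  \<open>t\<close> are both increased by one, so only \<open>s - t\<close> matters up to sign, and \<open>t = 0\<close> is immediate.
\<close>

lemma dOcagne_1:
  assumes G: "fib_rec G"
  shows "(- 1) powi (t - 1) * G (s - t) = F t * G (s + 1) - F (t + 1) * G s"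
proof -
  have "F t * G (r + t + 1) - F (t + 1) * G (r + t) = - ((- 1) powi t * G r)" for r
  proof (induction t rule: int_induct[where k = 0])
    case base
    then show ?case by (simp add: fib_int_def)
  next
    case (step1 t)
    then show ?case
      using fib_recD[OF G, of "r + t"] fib_recD[OF fib_rec_F, of t]
      by (simp add: power_int_add algebra_simps)
  next
    case (step2 t)
    then show ?case
      using fib_recD[OF G, of "r + t - 1"] fib_recD[OF fib_rec_F, of "t - 1"]
      by (simp add: power_int_diff algebra_simps)
  qed
  from this[of "s - t"] show ?thesis by (simp add: power_int_diff)
qed

lemma dOcagne:
  assumes G: "fib_rec G"
  shows "(- 1) powi (t - 1) * F k * G (s - t) = F t * G (s + k) - F (t + k) * G s"
proof -
  have "fib_rec (\<lambda>k. ((- 1) powi (t - 1) * G (s - t)) * F k)"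
    by (rule fib_rec_mult[OF fib_rec_F])
  moreover have "fib_rec (\<lambda>k. F t * G (s + k) - G s * F (t + k))"
    by (intro fib_rec_diff fib_rec_mult fib_rec_shift G fib_rec_F)
  ultimately have "((- 1) powi (t - 1) * G (s - t)) * F k = F t * G (s + k) - G s * F (t + k)"
    by (rule fib_rec_eqI) (use dOcagne_1[OF G, of t s] in \<open>simp_all add: F_0 F_1 mult.commute\<close>)
  then show ?thesis by (simp add: mult_ac)
qed

lemma sum_fib_rec:
  assumes G: "fib_rec G"
  shows "(- 1) powi (int n * k + t - 1) * F k *
           (\<Sum>j=0..n. (- 1) powi (k * int j) * G (int n * (s - k) + s - t + 2 * k * int j))
         = F t * G ((s + k) * (int n + 1)) - F (t + (int n + 1) * k) * G (s * (int n + 1))"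
proof -
  define S where "S = s * (int n + 1)"
  define A where "A j = F (t + k * (int n + 1 - int j)) * G (S + k * int j)" for j
  have summand: "(- 1) powi (int n * k + t - 1) * F k *
      ((- 1) powi (k * int j) * G (int n * (s - k) + s - t + 2 * k * int j)) = A (Suc j) - A j" for j
  proof -
    let ?t = "t + k * (int n - int j)" and ?s = "S + k * int j"
    \<comment> \<open>The signs agree because the exponents differ by the even number \<open>2 k j\<close>.\<close>
    have "(- 1 :: real) powi (int n * k + t - 1) * (- 1) powi (k * int j)
        = (- 1) powi ((?t - 1) + 2 * (k * int j))"
      by (simp add: power_int_add[symmetric] algebra_simps)
    also have "\<dots> = (- 1) powi (?t - 1)"
      by (subst power_int_add) (simp_all add: power_int_mult)
    finally have sign: "(- 1 :: real) powi (int n * k + t - 1) * (- 1) powi (k * int j)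
        = (- 1) powi (?t - 1)" .
    have index: "int n * (s - k) + s - t + 2 * k * int j = ?s - ?t"
      by (simp add: S_def algebra_simps)
    have "(- 1) powi (int n * k + t - 1) * F k *
        ((- 1) powi (k * int j) * G (int n * (s - k) + s - t + 2 * k * int j))
        = ((- 1) powi (int n * k + t - 1) * (- 1) powi (k * int j)) * F k * G (?s - ?t)"
      unfolding index by (simp only: mult_ac)
    also have "\<dots> = F ?t * G (?s + k) - F (?t + k) * G ?s"
      unfolding sign by (rule dOcagne[OF G])
    also have "\<dots> = A (Suc j) - A j"
      by (simp add: A_def algebra_simps)
    finally show ?thesis .
  qed
  have "(- 1) powi (int n * k + t - 1) * F k *
      (\<Sum>j=0..n. (- 1) powi (k * int j) * G (int n * (s - k) + s - t + 2 * k * int j))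
      = (\<Sum>j=0..n. A (Suc j) - A j)"
    by (simp only: sum_distrib_left summand)
  also have "\<dots> = A (Suc n) - A 0"
    by (simp add: sum_Suc_diff)
  also have "\<dots> = F t * G ((s + k) * (int n + 1)) - F (t + (int n + 1) * k) * G (s * (int n + 1))"
    by (simp add: A_def S_def algebra_simps)
  finally show ?thesis .
qed

theorem theorem5:
  fixes n :: nat and k s t :: int
  shows "((- 1) powi (int n * k + t - 1) * F k *
          (\<Sum>j=0..n. (- 1) powi (k * int j) * F (int n * (s - k) + s - t + 2 * k * int j))
        = F t * F ((s + k) * (int n + 1)) - F (t + (int n + 1) * k) * F (s * (int n + 1)))
     \<and> ((- 1) powi (int n * k + t - 1) * F k *
          (\<Sum>j=0..n. (- 1) powi (k * int j) * L (int n * (s - k) + s - t + 2 * k * int j))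
        = F t * L ((s + k) * (int n + 1)) - F (t + (int n + 1) * k) * L (s * (int n + 1)))
     \<and> ((- 1) powi (int n * t + k - 1) * F t *
          (\<Sum>j=0..n. (- 1) powi (t * int j) * F (int n * (s - t) + s - k + 2 * t * int j))
        = F k * F ((s + t) * (int n + 1)) - F (k + (int n + 1) * t) * F (s * (int n + 1)))
     \<and> ((- 1) powi (int n * t + k - 1) * F t *
          (\<Sum>j=0..n. (- 1) powi (t * int j) * L (int n * (s - t) + s - k + 2 * t * int j))
        = F k * L ((s + t) * (int n + 1)) - F (k + (int n + 1) * t) * L (s * (int n + 1)))
     \<and> ((- 1) powi (int n * s + t - 1) * F s *
          (\<Sum>j=0..n. (- 1) powi (s * int j) * F (int n * (k - s) + k - t + 2 * s * int j))
        = F t * F ((k + s) * (int n + 1)) - F (t + (int n + 1) * s) * F (k * (int n + 1)))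
     \<and> ((- 1) powi (int n * s + t - 1) * F s *
          (\<Sum>j=0..n. (- 1) powi (s * int j) * L (int n * (k - s) + k - t + 2 * s * int j))
        = F t * L ((k + s) * (int n + 1)) - F (t + (int n + 1) * s) * L (k * (int n + 1)))"
  by (intro conjI sum_fib_rec fib_rec_F fib_rec_L)

end
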